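(* Let $\{\Lambda_n\}_{n\in\mathbb N}$ be an $E$-$g$-frame for $\mathcal H$, let $\Gamma_n\in\mathcal B(\mathcal H,\mathcal H_n)$ for all $n\in\mathbb N$, and let $\{a_n\}_{n=1}^{\infty}$ and $\{b_n\}_{n=1}^{\infty}$ be positively confined sequences. If there exist constants $0\leq \alpha,\beta<\frac12$ such that for every $f\in\mathcal H$ $$\sum_{n=1}^{\infty}\left\|a_n\sum_{k=1}^{\infty}E_{n,k}\Lambda_kf-b_n\sum_{k=1}^{\infty}E_{n,k}\Gamma_kf\right\|^2\leq\alpha\sum_{n=1}^{\infty}\left\|a_n\sum_{k=1}^{\infty}E_{n,k}\Lambda_kf\right\|^2+\beta\sum_{n=1}^{\infty}\left\|b_n\sum_{k=1}^{\infty}E_{n,k}\Gamma_kf\right\|^2,$$ then $\{\Gamma_n\}_{n\in\mathbb N}$ is an $E$-$g$-frame for $\mathcal H$.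
   Context: $\mathcal H$ is an infinite-dimensional separable Hilbert space, $\{\mathcal H_n\}_{n\in\mathbb N}$ is a sequence of closed subspaces of $\mathcal H$, and $\mathcal B(\mathcal H,\mathcal H_n)$ is the space of bounded linear operators from $\mathcal H$ into $\mathcal H_n$. The space $(\oplus_{n=1}^{\infty}\mathcal H_n)_{\ell^2}$ consists of all sequences $\{f_n\}_{n=1}^\infty$ with $f_n\in\mathcal H_n$ and $\sum_{n=1}^\infty\|f_n\|^2<\infty$; it is a Hilbert space with inner product $\langle\{f_n\},\{g_n\}\rangle=\sum_{n=1}^{\infty}\langle f_n,g_n\rangle$. $E=(E_{n,k})_{n,k\ge1}$ is an infinite matrix of real or complex numbers which is an invertible matrix mapping on $(\oplus_{n=1}^{\infty}\mathcal H_n)_{\ell^2}$, where a matrix mapping sends a sequence $x=\{x_n\}_{n=1}^\infty$ to the sequence $Ex=\{(Ex)_n\}_{n=1}^\infty$ with $(Ex)_n=\sum_{k=1}^{\infty}E_{n,k}x_k$. A sequence $\{\Lambda_n\}_{n\in\mathbb N}$ with $\Lambda_n\in\mathcal B(\mathcal H,\mathcal H_n)$ is an $E$-$g$-frame for $\mathcal H$ if there exist positive real numbers $A,B$ (called $E$-$g$-frame bounds) such that $A\|f\|^2\leq \sum_{n=1}^{\infty}\left\|\sum_{k=1}^{\infty}E_{n,k}\Lambda_kf\right\|^2\leq B\|f\|^2$ for all $f\in \mathcal H$. A sequence $\{a_n\}_{n=1}^{\infty}$ in $\mathbb C$ is positively confined if $0<\inf_{n\in\mathbb N}|a_n|\leq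 \sup_{n\in\mathbb N}|a_n|<\infty$.
   Formalization: The series Σ_k E_{n,k}Γ_k f and the left-hand series of the inequality are assumed to converge for every f; if infinite sums were allowed (∞ ≤ ∞), the claim would fail, e.g. for E the identity, H_n = H, Γ_n f = n f and β > 0. *)

theory Defs
  imports "HOL-Analysis.Analysis"
begin

text \<open>
  A complex inner product space is a real inner product space carrying a scalar multiplication by
  complex numbers and a sesquilinear form whose real part is the real inner product. Hence
  \<open>norm x = sqrt (Re (cinner x x))\<close>, and positive definiteness of \<open>cinner\<close> is inherited
  from \<^class>\<open>real_inner\<close>. The form is linear in its first argument.
\<close>

class complex_inner = real_inner +
  fixes scaleC :: "complex \<Rightarrow> 'a \<Rightarrow> 'a"  (infixr "*C" 75)
    and cinner :: "'a \<Rightarrow> 'a \<Rightarrow> complex"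
  assumes scaleC_add_right: "c *C (x + y) = c *C x + c *C y"
    and scaleC_add_left: "(c + d) *C x = c *C x + d *C x"
    and scaleC_scaleC: "c *C (d *C x) = (c * d) *C x"
    and scaleR_scaleC: "scaleR r x = complex_of_real r *C x"
    and cinner_commute: "cinner x y = cnj (cinner y x)"
    and cinner_add_left: "cinner (x + y) z = cinner x z + cinner y z"
    and cinner_scaleC_left: "cinner (c *C x) y = c * cinner x y"
    and inner_eq_Re_cinner: "inner x y = Re (cinner x y)"

class complex_hilbert = complex_inner + complete_space

instantiation complex :: complex_hilbert
begin

definition "scaleC_complex = ((*) :: complex \<Rightarrow> complex \<Rightarrow> complex)"
definition "cinner_complex x (y :: complex) = x * cnj y"

instance
  by standard
    (auto simp: scaleC_complex_def cinner_complex_def algebra_simps scaleR_conv_of_real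
      inner_complex_def)

end

lemma scaleC_one: "1 *C x = x"
  for x :: "'a::complex_inner"
  using scaleR_scaleC[of 1 x] by simp

global_interpretation complex_vector: vector_space "scaleC :: complex \<Rightarrow> 'a \<Rightarrow> 'a::complex_inner"
  defines cspan = complex_vector.span
    and csubspace = complex_vector.subspace
  by unfold_locales (simp_all add: scaleC_add_right scaleC_add_left scaleC_scaleC scaleC_one)

definition closed_csubspace :: "'a::complex_inner set \<Rightarrow> bool"
  where "closed_csubspace S \<longleftrightarrow> csubspace S \<and> closed S"

definition infinite_dimensional :: "'a::complex_inner itself \<Rightarrow> bool"
  where "infinite_dimensional _ \<longleftrightarrow> \<not> (\<exists>B :: 'a set. finite B \<and> cspan B = UNIV)"

text \<open>The space of bounded (complex-)linear operators from the whole space into the subspace \<open>S\<close>.\<close>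

definition bounded_ops_into :: "'a::complex_inner set \<Rightarrow> ('a \<Rightarrow> 'a) set"
  where "bounded_ops_into S =
    {T. bounded_linear T \<and> (\<forall>c x. T (c *C x) = c *C T x) \<and> range T \<subseteq> S}"

text \<open>Sequences are indexed from \<open>0\<close> instead of \<open>1\<close> throughout.\<close>

definition l2_direct_sum :: "(nat \<Rightarrow> 'a::complex_inner set) \<Rightarrow> (nat \<Rightarrow> 'a) set"
  where "l2_direct_sum Hs = {f. (\<forall>n. f n \<in> Hs n) \<and> summable (\<lambda>n. (norm (f n))\<^sup>2)}"

definition mat_map :: "(nat \<Rightarrow> nat \<Rightarrow> complex) \<Rightarrow> (nat \<Rightarrow> 'a) \<Rightarrow> nat \<Rightarrow> 'a::complex_inner"
  where "mat_map E x n = (\<Sum>k. E n k *C x k)"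

text \<open>
  \<^const>\<open>suminf\<close> has an unspecified value on divergent series, so the convergence of the series that
  define \<open>mat_map E x\<close> is always stated separately.
\<close>

definition mat_map_converges ::
    "(nat \<Rightarrow> nat \<Rightarrow> complex) \<Rightarrow> (nat \<Rightarrow> 'a::complex_inner) \<Rightarrow> bool"
  where "mat_map_converges E x \<longleftrightarrow> (\<forall>n. summable (\<lambda>k. E n k *C x k))"

definition invertible_matrix_mapping ::
    "(nat \<Rightarrow> nat \<Rightarrow> complex) \<Rightarrow> (nat \<Rightarrow> 'a::complex_inner) set \<Rightarrow> bool"
  where "invertible_matrix_mapping E X \<longleftrightarrow>
    (\<forall>x\<in>X. mat_map_converges E x) \<and> bij_betw (mat_map E) X X"

definition E_g_frame ::
    "(nat \<Rightarrow> nat \<Rightarrow> complex) \<Rightarrow> (nat \<Rightarrow> 'a::complex_inner set) \<Rightarrow> (nat \<Rightarrow> 'a \<Rightarrow> 'a) \<Rightarrow> bool"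
  where "E_g_frame E Hs \<Lambda> \<longleftrightarrow>
    (\<forall>n. \<Lambda> n \<in> bounded_ops_into (Hs n)) \<and>
    (\<exists>A>0. \<exists>B>0. \<forall>f.
      mat_map_converges E (\<lambda>k. \<Lambda> k f) \<and>
      summable (\<lambda>n. (norm (mat_map E (\<lambda>k. \<Lambda> k f) n))\<^sup>2) \<and>
      A * (norm f)\<^sup>2 \<le> (\<Sum>n. (norm (mat_map E (\<lambda>k. \<Lambda> k f) n))\<^sup>2) \<and>
      (\<Sum>n. (norm (mat_map E (\<lambda>k. \<Lambda> k f) n))\<^sup>2) \<le> B * (norm f)\<^sup>2)"

text \<open>Boundedness above expresses that the supremum is finite.\<close>

definition positively_confined :: "(nat \<Rightarrow> complex) \<Rightarrow> bool"
  where "positively_confined a \<longleftrightarrow>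
    0 < (INF n. norm (a n)) \<and> bdd_above (range (\<lambda>n. norm (a n)))"

end

theory Submission
  imports Defs
begin

text \<open>
  Fix \<open>f\<close> and put \<open>u n = a n *C (E \<Lambda> f) n\<close> and \<open>v n = b n *C (E \<Gamma> f) n\<close>, with squared
  \<open>\<ell>\<^sup>2\<close> norms \<open>U\<close> and \<open>V\<close>, and let \<open>W\<close> be the squared \<open>\<ell>\<^sup>2\<close> norm of \<open>u - v\<close>. The
  estimate \<open>(s + t)\<^sup>2 \<le> 2 s\<^sup>2 + 2 t\<^sup>2\<close> gives \<open>V \<le> 2 U + 2 W\<close> and \<open>U \<le> 2 V + 2 W\<close>.
  Inserting the hypothesis \<open>W \<le> \<alpha> U + \<beta> V\<close> yields
  \<open>(1 - 2 \<beta>) V \<le> (2 + 2 \<alpha>) U\<close> and \<open>(1 - 2 \<alpha>) U \<le> (2 + 2 \<beta>) V\<close>. The factors on the left are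
  positive exactly because \<open>\<alpha>\<close> and \<open>\<beta>\<close> lie below one half, so \<open>U\<close> and \<open>V\<close> are comparable,
  uniformly in \<open>f\<close> (\<open>perturbation_comparable\<close>).

  A positively confined weight changes a squared \<open>\<ell>\<^sup>2\<close> norm by no more than a constant factor in
  either direction (\<open>weighted_square_sum_bounds\<close>). Hence \<open>U\<close> and \<open>V\<close> may be replaced by the
  unweighted sums for \<open>\<Lambda>\<close> and \<open>\<Gamma>\<close>, and the frame inequalities pass from \<open>\<Lambda>\<close> to \<open>\<Gamma>\<close>.
\<close>

text \<open>
  The class ties the norm to the complex structure only through the real part of \<^const>\<open>cinner\<close>, so
  homogeneity for complex scalars comes from sesquilinearity: the factor that \<open>c\<close> contributes to
  \<open>cinner (c *C x) (c *C x)\<close> is the real number \<open>c * cnj c\<close>.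
\<close>

lemma norm_scaleC: "norm (c *C x) = cmod c * norm (x :: 'a::complex_inner)"
proof -
  have "cinner (c *C x) (c *C x) = c * cinner x (c *C x)"
    by (rule cinner_scaleC_left)
  also have "cinner x (c *C x) = cnj c * cinner x x"
    by (metis cinner_commute cinner_scaleC_left complex_cnj_mult)
  finally have "cinner (c *C x) (c *C x) = of_real ((cmod c)\<^sup>2) * cinner x x"
    by (simp add: complex_norm_square del: of_real_power)
  then have "(norm (c *C x))\<^sup>2 = (cmod c * norm x)\<^sup>2"
    unfolding power2_norm_eq_inner power_mult_distrib inner_eq_Re_cinner
    by (simp del: of_real_power)
  then show ?thesis
    by (simp add: power2_eq_iff_nonneg)
qed

lemma positively_confined_bounds:
  assumes "positively_confined a"
  obtains m M where "0 < m" "\<And>n. m \<le> cmod (a n)" "0 < M" "\<And>n. cmod (a n) \<le> M"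
proof -
  let ?m = "INF n. cmod (a n)" and ?M = "SUP n. cmod (a n)"
  have m: "0 < ?m" and bdd: "bdd_above (range (\<lambda>n. cmod (a n)))"
    using assms by (auto simp: positively_confined_def)
  have lower: "?m \<le> cmod (a n)" for n
    by (rule cINF_lower) (auto intro: bdd_belowI[where m = 0])
  have upper: "cmod (a n) \<le> ?M" for n
    using bdd by (intro cSUP_upper) auto
  have "0 < ?M"
    using m lower[of 0] upper[of 0] by linarith
  then show thesis
    by (intro that[OF m lower _ upper])
qed

lemma weighted_square_sum_bounds:
  fixes x :: "nat \<Rightarrow> 'a::complex_inner"
  assumes m: "0 < m" "\<And>n. m \<le> cmod (a n)" and M: "\<And>n. cmod (a n) \<le> M"
  shows "summable (\<lambda>n. (norm (a n *C x n))\<^sup>2) \<longleftrightarrow> summable (\<lambda>n. (norm (x n))\<^sup>2)"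
    and "summable (\<lambda>n. (norm (x n))\<^sup>2) \<Longrightarrow>
      m\<^sup>2 * (\<Sum>n. (norm (x n))\<^sup>2) \<le> (\<Sum>n. (norm (a n *C x n))\<^sup>2)"
    and "summable (\<lambda>n. (norm (x n))\<^sup>2) \<Longrightarrow>
      (\<Sum>n. (norm (a n *C x n))\<^sup>2) \<le> M\<^sup>2 * (\<Sum>n. (norm (x n))\<^sup>2)"
proof -
  have lower: "m\<^sup>2 * (norm (x n))\<^sup>2 \<le> (norm (a n *C x n))\<^sup>2" for n
    using m by (auto simp: norm_scaleC power_mult_distrib intro!: mult_right_mono power_mono)
  have upper: "(norm (a n *C x n))\<^sup>2 \<le> M\<^sup>2 * (norm (x n))\<^sup>2" for n
    using M by (auto simp: norm_scaleC power_mult_distrib intro!: mult_right_mono power_mono)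
  have weighted: "summable (\<lambda>n. (norm (a n *C x n))\<^sup>2)" if "summable (\<lambda>n. (norm (x n))\<^sup>2)"
    by (rule summable_comparison_test'[OF summable_mult[OF that, of "M\<^sup>2"]]) (use upper in simp)
  have unweighted: "summable (\<lambda>n. (norm (x n))\<^sup>2)" if "summable (\<lambda>n. (norm (a n *C x n))\<^sup>2)"
  proof -
    have "summable (\<lambda>n. m\<^sup>2 * (norm (x n))\<^sup>2)"
      by (rule summable_comparison_test'[OF that]) (use lower in simp)
    then show ?thesis
      using m(1) by (subst (asm) summable_cmult_iff) auto
  qed
  show "summable (\<lambda>n. (norm (a n *C x n))\<^sup>2) \<longleftrightarrow> summable (\<lambda>n. (norm (x n))\<^sup>2)"
    using weighted unweighted by blast
  assume x: "summable (\<lambda>n. (norm (x n))\<^sup>2)"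
  show "m\<^sup>2 * (\<Sum>n. (norm (x n))\<^sup>2) \<le> (\<Sum>n. (norm (a n *C x n))\<^sup>2)"
    unfolding suminf_mult[OF x, symmetric]
    by (intro suminf_le lower summable_mult x weighted)
  show "(\<Sum>n. (norm (a n *C x n))\<^sup>2) \<le> M\<^sup>2 * (\<Sum>n. (norm (x n))\<^sup>2)"
    unfolding suminf_mult[OF x, symmetric]
    by (intro suminf_le upper summable_mult x weighted)
qed

lemma norm_square_le_double:
  fixes x y :: "'a::real_normed_vector"
  shows "(norm y)\<^sup>2 \<le> 2 * (norm x)\<^sup>2 + 2 * (norm (x - y))\<^sup>2"
proof -
  have "norm y \<le> norm x + norm (x - y)"
    by (metis norm_minus_commute norm_triangle_sub)
  then have "(norm y)\<^sup>2 \<le> (norm x + norm (x - y))\<^sup>2"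
    by (intro power_mono) auto
  also have "\<dots> \<le> 2 * (norm x)\<^sup>2 + 2 * (norm (x - y))\<^sup>2"
    using sum_squares_bound[of "norm x" "norm (x - y)"] by (simp add: power2_sum)
  finally show ?thesis .
qed

lemma square_sum_le_double:
  fixes x y :: "nat \<Rightarrow> 'a::real_normed_vector"
  assumes x: "summable (\<lambda>n. (norm (x n))\<^sup>2)" and d: "summable (\<lambda>n. (norm (x n - y n))\<^sup>2)"
  shows "summable (\<lambda>n. (norm (y n))\<^sup>2)"
    and "(\<Sum>n. (norm (y n))\<^sup>2) \<le> 2 * (\<Sum>n. (norm (x n))\<^sup>2) + 2 * (\<Sum>n. (norm (x n - y n))\<^sup>2)"
proof -
  have majorant: "summable (\<lambda>n. 2 * (norm (x n))\<^sup>2 + 2 * (norm (x n - y n))\<^sup>2)"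
    by (intro summable_add summable_mult x d)
  show y: "summable (\<lambda>n. (norm (y n))\<^sup>2)"
    by (rule summable_comparison_test'[OF majorant]) (simp add: norm_square_le_double)
  have "(\<Sum>n. (norm (y n))\<^sup>2) \<le> (\<Sum>n. 2 * (norm (x n))\<^sup>2 + 2 * (norm (x n - y n))\<^sup>2)"
    by (intro suminf_le norm_square_le_double y majorant)
  also have "\<dots> = 2 * (\<Sum>n. (norm (x n))\<^sup>2) + 2 * (\<Sum>n. (norm (x n - y n))\<^sup>2)"
    by (simp add: suminf_add[symmetric] suminf_mult summable_mult x d)
  finally show "(\<Sum>n. (norm (y n))\<^sup>2)
      \<le> 2 * (\<Sum>n. (norm (x n))\<^sup>2) + 2 * (\<Sum>n. (norm (x n - y n))\<^sup>2)" .
qed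

text \<open>
  The hypothesis bounds the difference partly by \<open>v\<close> itself, so the resulting \<open>2 \<beta> V\<close>, and
  likewise \<open>2 \<alpha> U\<close>, is absorbed into the left-hand side. This subtraction needs \<open>V\<close> to be
  finite, which is why summability is proved before the estimates.
\<close>

lemma perturbation_comparable:
  fixes u v :: "nat \<Rightarrow> 'a::real_normed_vector"
  defines "U \<equiv> \<Sum>n. (norm (u n))\<^sup>2" and "V \<equiv> \<Sum>n. (norm (v n))\<^sup>2"
  assumes u: "summable (\<lambda>n. (norm (u n))\<^sup>2)" and d: "summable (\<lambda>n. (norm (u n - v n))\<^sup>2)"
    and le: "(\<Sum>n. (norm (u n - v n))\<^sup>2) \<le> \<alpha> * U + \<beta> * V"
  shows "summable (\<lambda>n. (norm (v n))\<^sup>2)"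
    and "(1 - 2 * \<beta>) * V \<le> (2 + 2 * \<alpha>) * U"
    and "(1 - 2 * \<alpha>) * U \<le> (2 + 2 * \<beta>) * V"
proof -
  show v: "summable (\<lambda>n. (norm (v n))\<^sup>2)"
    by (rule square_sum_le_double(1)[OF u d])
  have d': "summable (\<lambda>n. (norm (v n - u n))\<^sup>2)"
    using d by (simp add: norm_minus_commute)
  have "V \<le> 2 * U + 2 * (\<Sum>n. (norm (u n - v n))\<^sup>2)"
    unfolding U_def V_def by (rule square_sum_le_double(2)[OF u d])
  with le show "(1 - 2 * \<beta>) * V \<le> (2 + 2 * \<alpha>) * U"
    by (simp add: algebra_simps)
  have "U \<le> 2 * V + 2 * (\<Sum>n. (norm (u n - v n))\<^sup>2)"
    unfolding U_def V_def
    using square_sum_le_double(2)[OF v d'] by (simp add: norm_minus_commute)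
  with le show "(1 - 2 * \<alpha>) * U \<le> (2 + 2 * \<beta>) * V"
    by (simp add: algebra_simps)
qed

theorem theorem2p8:
  fixes Hs :: "nat \<Rightarrow> 'a::complex_hilbert set"
    and E :: "nat \<Rightarrow> nat \<Rightarrow> complex"
    and \<Lambda> \<Gamma> :: "nat \<Rightarrow> 'a \<Rightarrow> 'a"
    and a b :: "nat \<Rightarrow> complex"
    and \<alpha> \<beta> :: real
  assumes "infinite_dimensional TYPE('a)"
    and "separable_space (euclidean :: 'a topology)"
    and "\<And>n. closed_csubspace (Hs n)"
    and "invertible_matrix_mapping E (l2_direct_sum Hs)"
    and "E_g_frame E Hs \<Lambda>"
    and "\<And>n. \<Gamma> n \<in> bounded_ops_into (Hs n)"
    and "positively_confined a"
    and "positively_confined b"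
    and "0 \<le> \<alpha>" "\<alpha> < 1 / 2"
    and "0 \<le> \<beta>" "\<beta> < 1 / 2"
    and "\<And>f. mat_map_converges E (\<lambda>k. \<Gamma> k f)"
    and "\<And>f. summable (\<lambda>n. (norm (a n *C mat_map E (\<lambda>k. \<Lambda> k f) n
                                - b n *C mat_map E (\<lambda>k. \<Gamma> k f) n))\<^sup>2)"
    and "\<And>f. (\<Sum>n. (norm (a n *C mat_map E (\<lambda>k. \<Lambda> k f) n
                         - b n *C mat_map E (\<lambda>k. \<Gamma> k f) n))\<^sup>2)
            \<le> \<alpha> * (\<Sum>n. (norm (a n *C mat_map E (\<lambda>k. \<Lambda> k f) n))\<^sup>2)
              + \<beta> * (\<Sum>n. (norm (b n *C mat_map E (\<lambda>k. \<Gamma> k f) n))\<^sup>2)"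
  shows "E_g_frame E Hs \<Gamma>"
proof -
  obtain A B where AB: "0 < A" "0 < B"
    and frame: "\<And>f. summable (\<lambda>n. (norm (mat_map E (\<lambda>k. \<Lambda> k f) n))\<^sup>2)"
      "\<And>f. A * (norm f)\<^sup>2 \<le> (\<Sum>n. (norm (mat_map E (\<lambda>k. \<Lambda> k f) n))\<^sup>2)"
      "\<And>f. (\<Sum>n. (norm (mat_map E (\<lambda>k. \<Lambda> k f) n))\<^sup>2) \<le> B * (norm f)\<^sup>2"
    using assms(5) unfolding E_g_frame_def by blast
  obtain ma Ma where a: "0 < ma" "\<And>n. ma \<le> cmod (a n)" "0 < Ma" "\<And>n. cmod (a n) \<le> Ma"
    using positively_confined_bounds[OF assms(7)] by blast
  obtain mb Mb where b: "0 < mb" "\<And>n. mb \<le> cmod (b n)" "0 < Mb" "\<And>n. cmod (b n) \<le> Mb"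
    using positively_confined_bounds[OF assms(8)] by blast
  note a_bounds = weighted_square_sum_bounds[where a = a, OF a(1,2,4)]
  note b_bounds = weighted_square_sum_bounds[where a = b, OF b(1,2,4)]
  \<comment> \<open>The constants obtained by composing three comparisons: from the sums for \<open>\<Lambda>\<close> to \<open>U\<close>,
    from \<open>U\<close> to \<open>V\<close>, and from \<open>V\<close> to the sums for \<open>\<Gamma>\<close>.\<close>
  define A' where "A' = (1 - 2 * \<alpha>) * (ma\<^sup>2 * A) / ((2 + 2 * \<beta>) * Mb\<^sup>2)"
  define B' where "B' = (2 + 2 * \<alpha>) * (Ma\<^sup>2 * B) / ((1 - 2 * \<beta>) * mb\<^sup>2)"
  have "0 < A'" "0 < B'"
    using assms(9-12) AB a(1,3) b(1,3) by (auto simp: A'_def B'_def)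
  moreover have "summable (\<lambda>n. (norm (mat_map E (\<lambda>k. \<Gamma> k f) n))\<^sup>2) \<and>
      A' * (norm f)\<^sup>2 \<le> (\<Sum>n. (norm (mat_map E (\<lambda>k. \<Gamma> k f) n))\<^sup>2) \<and>
      (\<Sum>n. (norm (mat_map E (\<lambda>k. \<Gamma> k f) n))\<^sup>2) \<le> B' * (norm f)\<^sup>2" for f
  proof -
    let ?x = "mat_map E (\<lambda>k. \<Lambda> k f)" and ?y = "mat_map E (\<lambda>k. \<Gamma> k f)"
    let ?X = "\<Sum>n. (norm (?x n))\<^sup>2" and ?Y = "\<Sum>n. (norm (?y n))\<^sup>2"
    let ?U = "\<Sum>n. (norm (a n *C ?x n))\<^sup>2" and ?V = "\<Sum>n. (norm (b n *C ?y n))\<^sup>2"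
    have "summable (\<lambda>n. (norm (a n *C ?x n))\<^sup>2)"
      using frame(1) a_bounds(1) by blast
    note comparable = perturbation_comparable[OF this assms(14,15)]
    have y: "summable (\<lambda>n. (norm (?y n))\<^sup>2)"
      using comparable(1) b_bounds(1) by blast
    have "(1 - 2 * \<alpha>) * (ma\<^sup>2 * (A * (norm f)\<^sup>2)) \<le> (1 - 2 * \<alpha>) * (ma\<^sup>2 * ?X)"
      using assms(10) frame(2) by (intro mult_left_mono) auto
    also have "\<dots> \<le> (1 - 2 * \<alpha>) * ?U"
      using assms(10) a_bounds(2)[OF frame(1)] by (intro mult_left_mono) auto
    also have "\<dots> \<le> (2 + 2 * \<beta>) * ?V"
      by (rule comparable(3))
    also have "\<dots> \<le> (2 + 2 * \<beta>) * (Mb\<^sup>2 * ?Y)"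
      using assms(11) b_bounds(3)[OF y] by (intro mult_left_mono) auto
    finally have lower: "A' * (norm f)\<^sup>2 \<le> ?Y"
      using assms(11) b(3) by (simp add: A'_def pos_divide_le_eq mult_ac)
    have "(1 - 2 * \<beta>) * (mb\<^sup>2 * ?Y) \<le> (1 - 2 * \<beta>) * ?V"
      using assms(12) b_bounds(2)[OF y] by (intro mult_left_mono) auto
    also have "\<dots> \<le> (2 + 2 * \<alpha>) * ?U"
      by (rule comparable(2))
    also have "\<dots> \<le> (2 + 2 * \<alpha>) * (Ma\<^sup>2 * ?X)"
      using assms(9) a_bounds(3)[OF frame(1)] by (intro mult_left_mono) auto
    also have "\<dots> \<le> (2 + 2 * \<alpha>) * (Ma\<^sup>2 * (B * (norm f)\<^sup>2))"
      using assms(9) frame(3) by (intro mult_left_mono) auto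
    finally have upper: "?Y \<le> B' * (norm f)\<^sup>2"
      using assms(12) b(1) by (simp add: B'_def pos_le_divide_eq mult_ac)
    from y lower upper show ?thesis
      by blast
  qed
  ultimately show ?thesis
    unfolding E_g_frame_def using assms(6,13) by blast
qed

end
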